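(* Let $(X,d_X)$ be a compact geodesic space and $p \in X$. Let $T$ be an arbitrary compact metric tree. Then $$d_{\mathrm{GH}}(X,T_p) \leq 13\, d_{\mathrm{GH}}(X,T).$$
   Context: Geodesic space: a metric space in which any two points are joined by a path whose length equals their distance. Metric tree: a geodesic space in which, up to reparametrization, there is a unique simple (injective) path between each pair of points. $d_{\mathrm{GH}}$ is the Gromov-Hausdorff distance. For a compact connected topological space $X$ and continuous $f:X\to\mathbb{R}$, the merge function is $$m_f(x,x'):=\inf\{\sup(f|_A): A\subseteq X,\ x,x'\in A,\ A \text{ connected}\},$$ and $\mathrm{t}_f(x,x'):=2m_f(x,x')-f(x)-f(x')$ is a pseudometric on $X$. The merge metric tree $(T_f,\mathrm{t}_f)$ is the metric space obtained from $X$ by identifying points at $\mathrm{t}_f$-distance $0$. $T_p$ denotes the merge metric tree of the function $X\to\mathbb{R}$, $x\mapsto -d_X(p,x)$. *)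

theory Defs
  imports "HOL-Analysis.Analysis"
begin

section \<open>Geodesic spaces and metric trees\<close>

text \<open>Length of a path parametrized on the unit interval: supremum of the polygonal lengths over
  all partitions \<open>0 = t 0 \<le> \<dots> \<le> t n = 1\<close>.\<close>

definition path_length :: "('a \<Rightarrow> 'a \<Rightarrow> real) \<Rightarrow> (real \<Rightarrow> 'a) \<Rightarrow> ennreal" where
  "path_length d g =
     (SUP (n, t) \<in> {(n :: nat, t :: nat \<Rightarrow> real). t 0 = 0 \<and> t n = 1 \<and> (\<forall>i<n. t i \<le> t (Suc i))}.
        ennreal (\<Sum>i<n. d (g (t i)) (g (t (Suc i)))))"

locale geodesic_space = Metric_space M d for M :: "'a set" and d :: "'a \<Rightarrow> 'a \<Rightarrow> real" +
  assumes geodesic: "\<lbrakk>x \<in> M; y \<in> M\<rbrakk> \<Longrightarrow>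
    \<exists>g. pathin mtopology g \<and> g 0 = x \<and> g 1 = y \<and> path_length d g = ennreal (d x y)"

definition simple_path_between :: "'a topology \<Rightarrow> 'a \<Rightarrow> 'a \<Rightarrow> (real \<Rightarrow> 'a) \<Rightarrow> bool" where
  "simple_path_between X x y g \<longleftrightarrow> pathin X g \<and> inj_on g {0..1} \<and> g 0 = x \<and> g 1 = y"

text \<open>Only distinct endpoints are considered: for \<open>x = y\<close> the unique injective path lives on a
  one-point interval, and none is parametrized on the unit interval.\<close>

locale metric_tree = geodesic_space +
  assumes ex_simple_path: "\<lbrakk>x \<in> M; y \<in> M; x \<noteq> y\<rbrakk> \<Longrightarrow> \<exists>g. simple_path_between mtopology x y g"
    and unique_simple_path: "\<lbrakk>x \<in> M; y \<in> M; x \<noteq> y;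
        simple_path_between mtopology x y g; simple_path_between mtopology x y h\<rbrakk> \<Longrightarrow>
      \<exists>\<phi> \<psi>. homeomorphism {0..1::real} {0..1} \<phi> \<psi> \<and> (\<forall>s\<in>{0..1}. h s = g (\<phi> s))"


section \<open>Gromov--Hausdorff distance\<close>

definition hausdorff_distance :: "('a \<Rightarrow> 'a \<Rightarrow> real) \<Rightarrow> 'a set \<Rightarrow> 'a set \<Rightarrow> ennreal" where
  "hausdorff_distance d A B =
     Inf {ennreal e | e. 0 \<le> e \<and> (\<forall>a\<in>A. \<exists>b\<in>B. d a b \<le> e) \<and> (\<forall>b\<in>B. \<exists>a\<in>A. d a b \<le> e)}"

definition isometric_embedding ::
    "'a set \<Rightarrow> ('a \<Rightarrow> 'a \<Rightarrow> real) \<Rightarrow> 'b set \<Rightarrow> ('b \<Rightarrow> 'b \<Rightarrow> real) \<Rightarrow> ('a \<Rightarrow> 'b) \<Rightarrow> bool" where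
  "isometric_embedding X dX Z dZ f \<longleftrightarrow>
     f \<in> X \<rightarrow> Z \<and> (\<forall>x\<in>X. \<forall>x'\<in>X. dZ (f x) (f x') = dX x x')"

text \<open>Infimum of the Hausdorff distances between isometric copies of \<open>X\<close> and \<open>Y\<close> in a common
  metric space \<open>Z\<close>. Letting \<open>Z\<close> range over carriers in the sum type loses nothing: an ambient space
  can be restricted to the union of the two images, and this union injects into the sum type.\<close>

definition GH_distance ::
    "'a set \<Rightarrow> ('a \<Rightarrow> 'a \<Rightarrow> real) \<Rightarrow> 'b set \<Rightarrow> ('b \<Rightarrow> 'b \<Rightarrow> real) \<Rightarrow> ennreal" where
  "GH_distance X dX Y dY =
     Inf {hausdorff_distance dZ (f ` X) (g ` Y) | (Z :: ('a + 'b) set) dZ f g.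
            Metric_space Z dZ \<and> isometric_embedding X dX Z dZ f \<and> isometric_embedding Y dY Z dZ g}"


section \<open>Merge metric trees\<close>

definition merge_function :: "'a topology \<Rightarrow> ('a \<Rightarrow> real) \<Rightarrow> 'a \<Rightarrow> 'a \<Rightarrow> real" where
  "merge_function X f x x' = Inf {Sup (f ` A) | A. connectedin X A \<and> x \<in> A \<and> x' \<in> A}"

definition merge_pdist :: "'a topology \<Rightarrow> ('a \<Rightarrow> real) \<Rightarrow> 'a \<Rightarrow> 'a \<Rightarrow> real" where
  "merge_pdist X f x x' = 2 * merge_function X f x x' - f x - f x'"

definition merge_rel :: "'a topology \<Rightarrow> ('a \<Rightarrow> real) \<Rightarrow> ('a \<times> 'a) set" where
  "merge_rel X f = {(x, x'). x \<in> topspace X \<and> x' \<in> topspace X \<and> merge_pdist X f x x' = 0}"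

definition merge_tree :: "'a topology \<Rightarrow> ('a \<Rightarrow> real) \<Rightarrow> 'a set set" where
  "merge_tree X f = topspace X // merge_rel X f"

text \<open>The choice of representatives is immaterial, see \<open>merge_tree_dist_class\<close> below.\<close>

definition merge_tree_dist :: "'a topology \<Rightarrow> ('a \<Rightarrow> real) \<Rightarrow> 'a set \<Rightarrow> 'a set \<Rightarrow> real" where
  "merge_tree_dist X f C D = merge_pdist X f (SOME x. x \<in> C) (SOME y. y \<in> D)"

locale merge_setup =
  fixes X :: "'a topology" and f :: "'a \<Rightarrow> real"
  assumes compact: "compact_space X" and connected: "connected_space X"
    and cont: "continuous_map X euclideanreal f"
begin

lemma bdd: assumes "A \<subseteq> topspace X" shows "bdd_above (f ` A)" "bdd_below (f ` A)"
proof -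
  have "compact (f ` topspace X)"
    using image_compactin[OF _ cont] compact by (simp add: compact_space_def)
  then have "bounded (f ` A)"
    using assms by (meson bounded_subset compact_imp_bounded image_mono)
  then show "bdd_above (f ` A)" "bdd_below (f ` A)"
    by (auto simp: bounded_imp_bdd_above bounded_imp_bdd_below)
qed

lemma le_Sup: "connectedin X A \<Longrightarrow> x \<in> A \<Longrightarrow> f x \<le> Sup (f ` A)"
  by (meson bdd(1) cSUP_upper connectedin_subset_topspace)

lemma merge_function_lower:
  assumes "connectedin X A" "x \<in> A" "y \<in> A"
  shows "merge_function X f x y \<le> Sup (f ` A)"
  unfolding merge_function_def
  by (rule cInf_lower) (use assms in \<open>auto intro!: bdd_belowI[of _ "f x"] le_Sup\<close>)

lemma merge_function_greatest:
  assumes "x \<in> topspace X" "y \<in> topspace X"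
    and "\<And>A. connectedin X A \<Longrightarrow> x \<in> A \<Longrightarrow> y \<in> A \<Longrightarrow> c \<le> Sup (f ` A)"
  shows "c \<le> merge_function X f x y"
proof -
  have "connectedin X (topspace X)"
    using connected by (simp add: connectedin_topspace)
  then show ?thesis
    unfolding merge_function_def using assms by (intro cInf_greatest) auto
qed

lemma merge_function_near:
  assumes "x \<in> topspace X" "y \<in> topspace X" "merge_function X f x y < c"
  obtains A where "connectedin X A" "x \<in> A" "y \<in> A" "Sup (f ` A) < c"
  using merge_function_greatest[OF assms(1,2), of c] assms(3) by force

lemma merge_function_commute: "merge_function X f x y = merge_function X f y x"
  unfolding merge_function_def by (metis (lifting))

lemma merge_function_ge:
  assumes "x \<in> topspace X" "y \<in> topspace X"
  shows "f x \<le> merge_function X f x y" "f y \<le> merge_function X f x y"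
  using assms by (auto intro!: merge_function_greatest le_Sup)

lemma merge_function_self: "x \<in> topspace X \<Longrightarrow> merge_function X f x x = f x"
  using merge_function_lower[of "{x}" x x] merge_function_ge[of x x] by simp

lemma merge_function_ultra:
  assumes "x \<in> topspace X" "y \<in> topspace X" "z \<in> topspace X"
  shows "merge_function X f x z \<le> max (merge_function X f x y) (merge_function X f y z)"
proof (rule dense_ge)
  fix c assume "max (merge_function X f x y) (merge_function X f y z) < c"
  then obtain A B where A: "connectedin X A" "x \<in> A" "y \<in> A" "Sup (f ` A) < c"
    and B: "connectedin X B" "y \<in> B" "z \<in> B" "Sup (f ` B) < c"
    using assms by (metis max_less_iff_conj merge_function_near)
  have "connectedin X (A \<union> B)"
    using A B by (auto intro: connectedin_Un)
  then have "merge_function X f x z \<le> Sup (f ` (A \<union> B))"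
    using A B by (intro merge_function_lower) auto
  also have "\<dots> \<le> c"
    using le_Sup[OF A(1)] le_Sup[OF B(1)] A B by (intro cSUP_least) force+
  finally show "merge_function X f x z \<le> c" .
qed

lemma merge_pdist_nonneg:
  "\<lbrakk>x \<in> topspace X; y \<in> topspace X\<rbrakk> \<Longrightarrow> 0 \<le> merge_pdist X f x y"
  using merge_function_ge[of x y] by (simp add: merge_pdist_def)

lemma merge_pdist_self: "x \<in> topspace X \<Longrightarrow> merge_pdist X f x x = 0"
  by (simp add: merge_pdist_def merge_function_self)

lemma merge_pdist_commute: "merge_pdist X f x y = merge_pdist X f y x"
  by (simp add: merge_pdist_def merge_function_commute[of x y])

lemma merge_pdist_triangle:
  assumes "x \<in> topspace X" "y \<in> topspace X" "z \<in> topspace X"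
  shows "merge_pdist X f x z \<le> merge_pdist X f x y + merge_pdist X f y z"
  using merge_function_ultra[OF assms] merge_function_ge[of x y] merge_function_ge[of y z] assms
  by (simp add: merge_pdist_def max_def split: if_splits)

lemma merge_rel_equiv: "equiv (topspace X) (merge_rel X f)"
proof (rule equivI)
  show "trans (merge_rel X f)"
  proof (rule transI)
    fix x y z assume "(x, y) \<in> merge_rel X f" "(y, z) \<in> merge_rel X f"
    then show "(x, z) \<in> merge_rel X f"
      using merge_pdist_triangle[of x y z] merge_pdist_nonneg[of x z] by (auto simp: merge_rel_def)
  qed
qed (auto simp: merge_rel_def refl_on_def sym_def merge_pdist_self merge_pdist_commute)

lemma merge_tree_dist_class:
  assumes C: "C \<in> merge_tree X f" and D: "D \<in> merge_tree X f" and "x \<in> C" "y \<in> D"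
  shows "merge_tree_dist X f C D = merge_pdist X f x y"
proof -
  define x' where "x' = (SOME x. x \<in> C)"
  define y' where "y' = (SOME y. y \<in> D)"
  have "x' \<in> C" "y' \<in> D"
    unfolding x'_def y'_def using assms by (auto intro: someI)
  then have "(x, x') \<in> merge_rel X f" "(y, y') \<in> merge_rel X f"
    using assms merge_rel_equiv unfolding merge_tree_def by (metis in_quotient_imp_closed quotient_eq_iff)+
  then have *: "x \<in> topspace X" "x' \<in> topspace X" "y \<in> topspace X" "y' \<in> topspace X"
    and "merge_pdist X f x x' = 0" "merge_pdist X f y y' = 0"
    by (auto simp: merge_rel_def)
  then have "merge_pdist X f x y = merge_pdist X f x' y'"
    using merge_pdist_triangle[of x x' y] merge_pdist_triangle[of x' y' y]
      merge_pdist_triangle[of x' x y'] merge_pdist_triangle[of x y y']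
    by (simp add: merge_pdist_commute[of x' x] merge_pdist_commute[of y' y])
  then show ?thesis
    by (simp add: merge_tree_dist_def x'_def y'_def)
qed

end

end

theory Submission
  imports Defs
begin

text \<open>
  Write \<open>(x|y)\<^sub>p = (d p x + d p y - d x y) / 2\<close> for the Gromov product. The merge pseudometric of
  \<open>x \<mapsto> - d p x\<close> has the form \<open>t x y = d p x + d p y - 2 h x y\<close>, where \<open>h x y\<close> is the supremum, over
  the connected sets containing \<open>x\<close> and \<open>y\<close>, of the distance from \<open>p\<close> to such a set. Hence comparing \<open>t\<close> with
  \<open>d\<close> means comparing \<open>h x y\<close> with \<open>(x|y)\<^sub>p\<close>.

  A geodesic from \<open>x\<close> to \<open>y\<close> stays at distance at least \<open>(x|y)\<^sub>p\<close> from \<open>p\<close> by the triangle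
  inequality. So \<open>(x|y)\<^sub>p \<le> h x y\<close>, that is \<open>t \<le> d\<close>
  (lemma \<open>merge_pdist_le_dist\<close>).

  The converse estimate uses the tree \<open>T\<close>. In a metric tree the Gromov product satisfies the
  ultrametric inequality \<open>min (x|w)\<^sub>p (w|y)\<^sub>p \<le> (x|y)\<^sub>p\<close> (\<open>four_point_condition\<close>). This comes from the
  tripod shape of triangles: two geodesics \<open>[a,b]\<close> and \<open>[b,c]\<close>, spliced at the first point where they
  meet, form an injective path, which by uniqueness is \<open>[a,c]\<close>. If \<open>T\<close> is at
  Gromov--Hausdorff distance less than \<open>e\<close>, there is a map \<open>\<phi>\<close> from \<open>X\<close> to \<open>T\<close> that changes distances
  by at most \<open>2 e\<close>. Let \<open>A\<close> be connected, contain \<open>x\<close> and \<open>y\<close>, and stay at distance at least \<open>r\<close>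
  from \<open>p\<close>. Points \<open>a\<close>, \<open>b\<close> of \<open>A\<close> at distance less than \<open>\<epsilon>\<close> have images with Gromov product at
  least \<open>r - 3 e - \<epsilon> / 2\<close>, and the ultrametric inequality makes this bound transitive. As \<open>A\<close> is
  connected, the bound reaches the pair \<open>x\<close>, \<open>y\<close>. Going back to \<open>X\<close> costs another \<open>3 e\<close>, and
  \<open>\<epsilon> \<rightarrow> 0\<close> gives \<open>h x y \<le> (x|y)\<^sub>p + 6 e\<close>, that is \<open>d \<le> t + 12 e\<close>
  (lemma \<open>dist_le_merge_pdist\<close>).

  The quotient map from \<open>X\<close> to its merge tree is therefore distance-nonincreasing and loses at most
  \<open>12 e\<close>, so both spaces are at Gromov--Hausdorff distance at most \<open>6 e\<close>. This proves the inequality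
  with the constant 6, which is stronger than the one with 13.
\<close>

section \<open>Geodesics in metric spaces\<close>

context Metric_space
begin

definition geodesic_arc :: "'a \<Rightarrow> 'a \<Rightarrow> (real \<Rightarrow> 'a) \<Rightarrow> bool" where
  "geodesic_arc x y \<gamma> \<longleftrightarrow> \<gamma> \<in> {0..d x y} \<rightarrow> M \<and> \<gamma> 0 = x \<and> \<gamma> (d x y) = y
     \<and> (\<forall>s\<in>{0..d x y}. \<forall>t\<in>{0..d x y}. d (\<gamma> s) (\<gamma> t) = \<bar>s - t\<bar>)"

definition gromov_product :: "'a \<Rightarrow> 'a \<Rightarrow> 'a \<Rightarrow> real" where
  "gromov_product p x y = (d p x + d p y - d x y) / 2"

definition metric_segment :: "'a \<Rightarrow> 'a \<Rightarrow> 'a set" where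
  "metric_segment x y = {z \<in> M. d x z + d z y = d x y}"

lemma geodesic_arcD:
  assumes "geodesic_arc x y \<gamma>"
  shows "\<gamma> 0 = x" "\<gamma> (d x y) = y"
    and "s \<in> {0..d x y} \<Longrightarrow> \<gamma> s \<in> M"
    and "\<lbrakk>s \<in> {0..d x y}; t \<in> {0..d x y}\<rbrakk> \<Longrightarrow> d (\<gamma> s) (\<gamma> t) = \<bar>s - t\<bar>"
  using assms by (auto simp: geodesic_arc_def)

lemma geodesic_arc_inj_on:
  assumes "geodesic_arc x y \<gamma>"
  shows "inj_on \<gamma> {0..d x y}"
  using geodesic_arcD(3,4)[OF assms] by (intro inj_onI) (metis abs_eq_0 eq_iff_diff_eq_0 mdist_zero)

lemma geodesic_arc_in_segment:
  assumes "geodesic_arc x y \<gamma>" "s \<in> {0..d x y}"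
  shows "\<gamma> s \<in> metric_segment x y"
  using geodesic_arcD(4)[OF assms(1), of 0 s] geodesic_arcD(4)[OF assms(1), of s "d x y"]
    geodesic_arcD(1-3)[OF assms(1)] assms(2)
  by (auto simp: metric_segment_def)

text \<open>All paths built below by cutting, rescaling and concatenating geodesics are Lipschitz, which
  settles their continuity at once.\<close>

lemma Lipschitz_pathin:
  assumes "\<gamma> \<in> {0..1} \<rightarrow> M" "L > 0"
    and lip: "\<And>s t. \<lbrakk>s \<in> {0..1}; t \<in> {0..1}; s \<le> t\<rbrakk> \<Longrightarrow> d (\<gamma> s) (\<gamma> t) \<le> L * (t - s)"
  shows "pathin mtopology \<gamma>"
  unfolding pathin_def continuous_map_to_metric
proof (intro ballI allI impI)
  fix s \<epsilon> :: real assume s: "s \<in> topspace (top_of_set {0..1})" and "\<epsilon> > 0"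
  have "d (\<gamma> s) (\<gamma> t) < \<epsilon>" if "t \<in> {0..1}" "dist s t < \<epsilon> / L" for t
  proof -
    have "d (\<gamma> s) (\<gamma> t) \<le> L * \<bar>t - s\<bar>"
      using lip[of s t] lip[of t s] s that(1) by (cases "s \<le> t") (auto simp: commute)
    also have "\<dots> < \<epsilon>"
      using that(2) \<open>L > 0\<close> by (simp add: dist_real_def field_simps abs_minus_commute)
    finally show ?thesis .
  qed
  then show "\<exists>U. openin (top_of_set {0..1}) U \<and> s \<in> U \<and> (\<forall>t\<in>U. \<gamma> t \<in> mball (\<gamma> s) \<epsilon>)"
    using s assms(1,2) \<open>\<epsilon> > 0\<close>
    by (intro exI[of _ "{0..1} \<inter> ball s (\<epsilon> / L)"]) (auto simp: openin_open_Int in_mball Pi_iff)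
qed

lemma geodesic_arc_connectedin:
  assumes "geodesic_arc x y \<gamma>"
  shows "connectedin mtopology (\<gamma> ` {0..d x y})"
proof -
  note G = geodesic_arcD[OF assms]
  have scale: "(\<lambda>u. d x y * u) ` {0..1} = {0..d x y}"
    using nonneg[of x y] by (auto simp: image_mult_atLeastAtMost_if simp del: nonneg)
  have in_D: "d x y * u \<in> {0..d x y}" if "u \<in> {0..1}" for u
    using scale that by blast
  have "pathin mtopology (\<lambda>u. \<gamma> (d x y * u))"
  proof (rule Lipschitz_pathin[of _ "d x y + 1"])
    show "(\<lambda>u. \<gamma> (d x y * u)) \<in> {0..1} \<rightarrow> M" using G(3) in_D by auto
    show "0 < d x y + 1" using nonneg[of x y] by linarith
    fix s t :: real assume st: "s \<in> {0..1}" "t \<in> {0..1}" "s \<le> t"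
    then have "d (\<gamma> (d x y * s)) (\<gamma> (d x y * t)) = d x y * (t - s)"
      using G(4)[OF in_D in_D, of s t] nonneg[of x y]
      by (simp add: abs_mult flip: right_diff_distrib)
    then show "d (\<gamma> (d x y * s)) (\<gamma> (d x y * t)) \<le> (d x y + 1) * (t - s)"
      using st by (simp add: algebra_simps)
  qed
  then show ?thesis
    using connectedin_path_image scale by (metis image_image)
qed

lemma continuous_map_dist_from:
  assumes "p \<in> M"
  shows "continuous_map mtopology euclideanreal (d p)"
proof -
  have "\<exists>\<delta>>0. \<forall>x. x \<in> M \<and> d a x < \<delta> \<longrightarrow> dist (d p a) (d p x) < \<epsilon>" if "a \<in> M" "\<epsilon> > 0" for a \<epsilon>
    using that assms triangle[of p a] triangle[of p _ a] 
    by (intro exI[of _ \<epsilon>]) (smt (verit) commute dist_real_def)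
  then show ?thesis
    using metric_continuous_map[OF Met_TC.Metric_space_axioms, of "d p"] by simp
qed

text \<open>A path whose length is the distance of its endpoints may still pause. Inscribed polygons with
  two inner vertices show that the distance from \<open>x\<close> is nondecreasing along the path and that its
  increments are the distances between the points passed; choosing for each value of this distance
  one time at which it is attained gives a parametrization by arc length.\<close>

lemma geodesic_arc_exists:
  assumes "pathin mtopology g" "g 0 = x" "g 1 = y" and len: "path_length d g = ennreal (d x y)"
  obtains \<gamma> where "geodesic_arc x y \<gamma>"
proof -
  define D where "D = d x y"
  have gM: "g s \<in> M" if "s \<in> {0..1}" for s
    using path_image_subset_topspace[OF assms(1)] that by auto
  have xy: "x \<in> M" "y \<in> M"
    using gM[of 0] gM[of 1] assms by auto
  have short: "d x (g s) + d (g s) (g t) + d (g t) y \<le> D" if "0 \<le> s" "s \<le> t" "t \<le> 1" for s t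
  proof -
    define \<tau> :: "nat \<Rightarrow> real" where "\<tau> i = (if i = 0 then 0 else if i = 1 then s else if i = 2 then t else 1)" for i
    have "ennreal (\<Sum>i<3. d (g (\<tau> i)) (g (\<tau> (Suc i)))) \<le> path_length d g"
      unfolding path_length_def
      by (rule SUP_upper2[of "(3, \<tau>)"]) (use that in \<open>auto simp: \<tau>_def less_Suc_eq numeral_3_eq_3\<close>)
    then show ?thesis
      using len assms(2,3) by (simp add: \<tau>_def numeral_3_eq_3 D_def flip: ennreal_plus)
  qed
  define \<phi> where "\<phi> s = d x (g s)" for s
  have cont: "continuous_on {0..1} \<phi>"
    using continuous_map_compose[OF assms(1)[unfolded pathin_def] continuous_map_dist_from[OF xy(1)]]
    by (simp add: o_def \<phi>_def)
  have "\<exists>s\<in>{0..1}. \<phi> s = u" if "u \<in> {0..D}" for u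
    using IVT'[of \<phi> 0 u 1] that cont xy assms by (auto simp: \<phi>_def D_def)
  then obtain \<sigma> where \<sigma>: "\<And>u. u \<in> {0..D} \<Longrightarrow> \<sigma> u \<in> {0..1} \<and> \<phi> (\<sigma> u) = u"
    by metis
  have diff: "d (g s) (g t) = \<phi> t - \<phi> s" if "0 \<le> s" "s \<le> t" "t \<le> 1" for s t
    using short[OF that] triangle[of x "g s" "g t"] triangle[of x "g t" y] gM[of s] gM[of t] xy that
    by (auto simp: \<phi>_def D_def)
  have "d (g (\<sigma> u)) (g (\<sigma> v)) = \<bar>u - v\<bar>" if "u \<in> {0..D}" "v \<in> {0..D}" for u v
    using \<sigma>[OF that(1)] \<sigma>[OF that(2)] diff[of "\<sigma> u" "\<sigma> v"] diff[of "\<sigma> v" "\<sigma> u"]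
      nonneg[of "g (\<sigma> u)" "g (\<sigma> v)"]
    by (cases "\<sigma> u \<le> \<sigma> v") (auto simp: commute)
  moreover have "g (\<sigma> 0) = x"
    using \<sigma>[of 0] xy gM by (auto simp: \<phi>_def D_def)
  moreover have "g (\<sigma> D) = y"
  proof -
    have "\<sigma> D \<in> {0..1}" "\<phi> (\<sigma> D) = D"
      using \<sigma>[of D] by (auto simp: D_def)
    then have "d (g (\<sigma> D)) y = 0"
      using short[of "\<sigma> D" "\<sigma> D"] gM[of "\<sigma> D"] nonneg[of "g (\<sigma> D)" y]
      by (simp add: \<phi>_def del: nonneg)
    then show ?thesis using xy gM \<open>\<sigma> D \<in> {0..1}\<close> by simp
  qed
  ultimately have "geodesic_arc x y (\<lambda>u. g (\<sigma> u))"
    using \<sigma> gM by (auto simp: geodesic_arc_def D_def)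
  then show ?thesis by (rule that)
qed

lemma injective_Lipschitz_simple_path:
  assumes "0 < L"
    and \<eta>: "\<eta> \<in> {0..L} \<rightarrow> M" "\<eta> 0 = a" "\<eta> L = c" "inj_on \<eta> {0..L}"
    and lip: "\<And>u v. \<lbrakk>0 \<le> u; u \<le> v; v \<le> L\<rbrakk> \<Longrightarrow> d (\<eta> u) (\<eta> v) \<le> v - u"
  shows "simple_path_between mtopology a c (\<lambda>u. \<eta> (L * u))"
    and "(\<lambda>u. \<eta> (L * u)) ` {0..1} = \<eta> ` {0..L}"
proof -
  have scale: "(\<lambda>u. L * u) ` {0..1} = {0..L}"
    using \<open>0 < L\<close> by (simp add: image_mult_atLeastAtMost)
  have in_L: "L * u \<in> {0..L}" if "u \<in> {0..1}" for u
    using scale that by blast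
  have "pathin mtopology (\<lambda>u. \<eta> (L * u))"
  proof (rule Lipschitz_pathin[OF _ \<open>0 < L\<close>])
    show "(\<lambda>u. \<eta> (L * u)) \<in> {0..1} \<rightarrow> M" using \<eta>(1) in_L by auto
    fix s t :: real assume "s \<in> {0..1}" "t \<in> {0..1}" "s \<le> t"
    then show "d (\<eta> (L * s)) (\<eta> (L * t)) \<le> L * (t - s)"
      using lip[of "L * s" "L * t"] in_L[of s] in_L[of t] \<open>0 < L\<close> by (simp add: algebra_simps)
  qed
  moreover have "inj_on (\<lambda>u. \<eta> (L * u)) {0..1}"
    using inj_onD[OF \<eta>(4)] in_L \<open>0 < L\<close> by (intro inj_onI) (metis mult_cancel_left less_irrefl)
  ultimately show "simple_path_between mtopology a c (\<lambda>u. \<eta> (L * u))"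
    using \<eta> by (simp add: simple_path_between_def)
  show "(\<lambda>u. \<eta> (L * u)) ` {0..1} = \<eta> ` {0..L}"
    using scale by (metis image_image)
qed

text \<open>The path that follows a geodesic \<open>\<alpha>\<close> up to a point on a second geodesic \<open>\<beta>\<close> and then
  continues along \<open>\<beta>\<close>. It serves twice: for splicing two sides of a triangle at their first meeting
  point, and for concatenating two geodesics at a common endpoint.\<close>

lemma broken_geodesic_Lipschitz:
  assumes \<alpha>: "geodesic_arc a b \<alpha>" and \<beta>: "geodesic_arc b' c \<beta>"
    and s0: "s0 \<in> {0..d a b}" and t0: "t0 \<in> {0..d b' c}" and join: "\<alpha> s0 = \<beta> t0"
  defines "\<eta> \<equiv> \<lambda>u. if u \<le> s0 then \<alpha> u else \<beta> (t0 + (u - s0))"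
    and "L \<equiv> s0 + (d b' c - t0)"
  shows "\<eta> \<in> {0..L} \<rightarrow> M" "\<eta> 0 = a" "\<eta> L = c"
    and "\<lbrakk>0 \<le> u; u \<le> v; v \<le> L\<rbrakk> \<Longrightarrow> d (\<eta> u) (\<eta> v) \<le> v - u"
    and "\<eta> ` {0..L} = \<alpha> ` {0..s0} \<union> \<beta> ` {t0..d b' c}"
proof -
  note A = geodesic_arcD[OF \<alpha>] and B = geodesic_arcD[OF \<beta>]
  show "\<eta> \<in> {0..L} \<rightarrow> M" "\<eta> 0 = a" "\<eta> L = c"
    using A B s0 t0 join by (auto simp: \<eta>_def L_def)
  show "d (\<eta> u) (\<eta> v) \<le> v - u" if "0 \<le> u" "u \<le> v" "v \<le> L"
  proof -
    consider "v \<le> s0" | "u > s0" | "u \<le> s0" "v > s0" by linarith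
    then show ?thesis
    proof cases
      case 1 then show ?thesis using A(4)[of u v] that s0 by (auto simp: \<eta>_def)
    next
      case 2 then show ?thesis
        using B(4)[of "t0 + (u - s0)" "t0 + (v - s0)"] that t0 by (auto simp: \<eta>_def L_def)
    next
      case 3
      have "d (\<alpha> u) (\<beta> (t0 + (v - s0))) \<le> d (\<alpha> u) (\<alpha> s0) + d (\<beta> t0) (\<beta> (t0 + (v - s0)))"
        unfolding join[symmetric] using that 3 s0 t0
        by (intro triangle A(3) B(3)) (auto simp: L_def)
      also have "\<dots> = v - u"
        using A(4)[of u s0] B(4)[of t0 "t0 + (v - s0)"] that 3 s0 t0 by (auto simp: L_def)
      finally show ?thesis using 3 by (simp add: \<eta>_def)
    qed
  qed
  show "\<eta> ` {0..L} = \<alpha> ` {0..s0} \<union> \<beta> ` {t0..d b' c}"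
  proof (intro equalityI subsetI)
    fix z assume "z \<in> \<eta> ` {0..L}"
    then show "z \<in> \<alpha> ` {0..s0} \<union> \<beta> ` {t0..d b' c}"
      by (auto simp: \<eta>_def L_def)
  next
    fix z assume "z \<in> \<alpha> ` {0..s0} \<union> \<beta> ` {t0..d b' c}"
    then consider u where "u \<in> {0..s0}" "z = \<alpha> u" | t where "t \<in> {t0..d b' c}" "z = \<beta> t"
      by auto
    then show "z \<in> \<eta> ` {0..L}"
    proof cases
      case 1 then show ?thesis using t0 by (auto simp: \<eta>_def L_def intro!: image_eqI[of _ _ u])
    next
      case 2 
      then have "z = \<eta> (s0 + (t - t0))" using join by (auto simp: \<eta>_def)
      then show ?thesis using 2 s0 by (auto simp: L_def)
    qed
  qed
qed

text \<open>The pairs of parameters at which two geodesics coincide form a compact set, so the first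
  coordinate attains its minimum on it. Nonemptiness comes from the common endpoint \<open>b\<close>.\<close>

lemma first_meeting_point:
  assumes \<alpha>: "geodesic_arc a b \<alpha>" and \<beta>: "geodesic_arc b c \<beta>"
  obtains s0 t0 where "s0 \<in> {0..d a b}" "t0 \<in> {0..d b c}" "\<alpha> s0 = \<beta> t0"
    and "\<And>s t. \<lbrakk>s \<in> {0..s0}; t \<in> {0..d b c}; \<alpha> s = \<beta> t\<rbrakk> \<Longrightarrow> s = s0"
proof -
  note A = geodesic_arcD[OF \<alpha>] and B = geodesic_arcD[OF \<beta>]
  define Q where "Q = {0..d a b} \<times> {0..d b c}"
  define \<delta> where "\<delta> z = d (\<alpha> (fst z)) (\<beta> (snd z))" for z
  define K where "K = {z \<in> Q. \<delta> z = 0}"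
  have "dist (\<delta> z) (\<delta> w) \<le> 2 * dist z w" if "z \<in> Q" "w \<in> Q" for z w
  proof -
    obtain s t s' t' where zw: "z = (s, t)" "w = (s', t')" by (metis surj_pair)
    have "\<bar>\<delta> z - \<delta> w\<bar> \<le> d (\<alpha> s) (\<alpha> s') + d (\<beta> t) (\<beta> t')"
      using that A(3)[of s] A(3)[of s'] B(3)[of t] B(3)[of t']
        triangle[of "\<alpha> s" "\<alpha> s'" "\<beta> t"] triangle[of "\<alpha> s'" "\<beta> t'" "\<beta> t"]
        triangle[of "\<alpha> s'" "\<alpha> s" "\<beta> t'"] triangle[of "\<alpha> s" "\<beta> t" "\<beta> t'"]
      by (simp add: \<delta>_def zw Q_def commute[of "\<alpha> s'" "\<alpha> s"] commute[of "\<beta> t'" "\<beta> t"])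
    also have "\<dots> = dist (fst z) (fst w) + dist (snd z) (snd w)"
      using that A(4)[of s s'] B(4)[of t t'] by (simp add: zw Q_def dist_real_def)
    also have "\<dots> \<le> 2 * dist z w"
      using dist_fst_le[of z w] dist_snd_le[of z w] by linarith
    finally show ?thesis by (simp add: dist_real_def)
  qed
  then have "2-lipschitz_on Q \<delta>"
    by (auto intro!: lipschitz_onI)
  then have "continuous_on Q \<delta>"
    by (rule lipschitz_on_continuous_on)
  then have "closed K"
    unfolding K_def Q_def by (intro continuous_closed_preimage_constant closed_Times) auto
  moreover have "K = Q \<inter> K" by (auto simp: K_def)
  ultimately have "compact K"
    unfolding Q_def by (metis compact_Int_closed compact_Times compact_Icc)
  moreover have "(d a b, 0) \<in> K"
    using A B(1) B(3)[of 0] by (auto simp: K_def Q_def \<delta>_def)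
  moreover have "continuous_on K fst"
    by (intro continuous_intros)
  ultimately obtain z where z: "z \<in> K" "\<And>w. w \<in> K \<Longrightarrow> fst z \<le> fst w"
    using continuous_attains_inf[of K fst] by blast
  obtain s0 t0 where st: "z = (s0, t0)" by (metis surj_pair)
  show ?thesis
  proof (rule that[of s0 t0])
    show "s0 \<in> {0..d a b}" "t0 \<in> {0..d b c}" 
      using z(1) by (auto simp: K_def Q_def st)
    then show "\<alpha> s0 = \<beta> t0"
      using z(1) A(3) B(3) by (auto simp: K_def \<delta>_def st)
    fix s t assume "s \<in> {0..s0}" "t \<in> {0..d b c}" "\<alpha> s = \<beta> t"
    then have "(s, t) \<in> K"
      using \<open>s0 \<in> _\<close> B(3)[of t] by (auto simp: K_def Q_def \<delta>_def)
    then show "s = s0" using z(2)[of "(s, t)"] \<open>s \<in> _\<close> by (auto simp: st)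
  qed
qed

end

lemma (in geodesic_space) geodesic_arc_between:
  assumes "x \<in> M" "y \<in> M"
  obtains \<gamma> where "geodesic_arc x y \<gamma>"
  using geodesic[OF assms] geodesic_arc_exists by metis

section \<open>Metric trees satisfy the four-point condition\<close>

context metric_tree
begin

lemma simple_path_image_unique:
  assumes "x \<in> M" "y \<in> M" "x \<noteq> y"
    and g: "simple_path_between mtopology x y g" and h: "simple_path_between mtopology x y h"
  shows "g ` {0..1} = h ` {0..1}"
proof -
  obtain \<phi> \<psi> where hom: "homeomorphism {0..1::real} {0..1} \<phi> \<psi>"
    and eq: "\<forall>s\<in>{0..1}. h s = g (\<phi> s)"
    using unique_simple_path[OF assms] by blast
  have "h ` {0..1} = g ` \<phi> ` {0..1}"
    unfolding image_image using eq by (intro image_cong) auto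
  then show ?thesis
    unfolding homeomorphism_image1[OF hom] by (rule sym)
qed

text \<open>Geodesics, rescaled to the unit interval, are simple paths, so by uniqueness every geodesic from
  \<open>a\<close> to \<open>c\<close> has the image of \<open>\<eta>\<close>. A point of the metric segment lies on such a geodesic: the
  concatenation of two geodesics through that point.\<close>

lemma injective_Lipschitz_path_image:
  assumes "a \<in> M" "c \<in> M" "a \<noteq> c" 
    and \<eta>: "\<eta> \<in> {0..L} \<rightarrow> M" "\<eta> 0 = a" "\<eta> L = c" "inj_on \<eta> {0..L}" "0 \<le> L"
    and lip: "\<And>u v. \<lbrakk>0 \<le> u; u \<le> v; v \<le> L\<rbrakk> \<Longrightarrow> d (\<eta> u) (\<eta> v) \<le> v - u"
  shows "\<eta> ` {0..L} = metric_segment a c"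
proof -
  have "0 < L" using \<open>a \<noteq> c\<close> \<eta> by (cases "L = 0") auto
  note H = injective_Lipschitz_simple_path[OF \<open>0 < L\<close> \<eta>(1-4) lip]
  have D: "0 < d a c" using assms(1-3) by simp
  have geo: "\<gamma> ` {0..d a c} = \<eta> ` {0..L}" if "geodesic_arc a c \<gamma>" for \<gamma>
  proof -
    note G = geodesic_arcD[OF that]
    have "simple_path_between mtopology a c (\<lambda>u. \<gamma> (d a c * u))"
      "(\<lambda>u. \<gamma> (d a c * u)) ` {0..1} = \<gamma> ` {0..d a c}"
      by (intro injective_Lipschitz_simple_path[OF D]; use G geodesic_arc_inj_on[OF that] in auto)+
    then show ?thesis
      using simple_path_image_unique[OF assms(1-3)] H by metis
  qed
  show ?thesis
  proof (intro equalityI subsetI)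
    fix z assume z: "z \<in> \<eta> ` {0..L}"
    obtain \<gamma> where \<gamma>: "geodesic_arc a c \<gamma>"
      by (rule geodesic_arc_between[OF assms(1,2)])
    then obtain s where "s \<in> {0..d a c}" "z = \<gamma> s"
      using z geo[OF \<gamma>] by blast
    then show "z \<in> metric_segment a c"
      using geodesic_arc_in_segment[OF \<gamma>] by simp
  next
    fix z assume "z \<in> metric_segment a c"
    then have z: "z \<in> M" "d a z + d z c = d a c" by (auto simp: metric_segment_def)
    obtain \<alpha> \<beta> where \<alpha>: "geodesic_arc a z \<alpha>" and \<beta>: "geodesic_arc z c \<beta>"
      using geodesic_arc_between z(1) assms(1,2) by metis
    define \<gamma> where "\<gamma> u = (if u \<le> d a z then \<alpha> u else \<beta> (0 + (u - d a z)))" for u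
    have J: "\<alpha> (d a z) = \<beta> 0" using geodesic_arcD[OF \<alpha>] geodesic_arcD[OF \<beta>] by simp
    have L: "d a z + (d z c - 0) = d a c" using z by simp
    note K = broken_geodesic_Lipschitz[OF \<alpha> \<beta> _ _ J, folded \<gamma>_def, unfolded L, simplified]
    have le: "d (\<gamma> u) (\<gamma> v) = v - u" if "0 \<le> u" "u \<le> v" "v \<le> d a c" for u v
    proof (rule antisym)
      show "d (\<gamma> u) (\<gamma> v) \<le> v - u" using K(4) that by blast
      have "\<gamma> u \<in> M" "\<gamma> v \<in> M" using K(1) that by auto
      then have "d a c \<le> d a (\<gamma> u) + d (\<gamma> u) (\<gamma> v) + d (\<gamma> v) c"
        using triangle[of a "\<gamma> u" c] triangle[of "\<gamma> u" "\<gamma> v" c] assms(1,2) by linarith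
      then show "v - u \<le> d (\<gamma> u) (\<gamma> v)"
        using K(4)[of 0 u] K(4)[of v "d a c"] K(2,3) that by simp
    qed
    have "d (\<gamma> u) (\<gamma> v) = \<bar>u - v\<bar>" if "u \<in> {0..d a c}" "v \<in> {0..d a c}" for u v
      using le[of u v] le[of v u] that by (cases "u \<le> v") (auto simp: commute)
    then have "geodesic_arc a c \<gamma>"
      unfolding geodesic_arc_def using K(1-3) by blast
    then have "\<eta> ` {0..L} = \<gamma> ` {0..d a c}"
      by (rule geo[symmetric])
    moreover have "\<gamma> (d a z) = z"
      unfolding \<gamma>_def using geodesic_arcD(2)[OF \<alpha>] by auto
    moreover have "d a z \<in> {0..d a c}"
      using nonneg[of a z] nonneg[of z c] unfolding atLeastAtMost_iff z(2)[symmetric] by linarith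
    ultimately show "z \<in> \<eta> ` {0..L}" by (metis imageI)
  qed
qed

text \<open>Following a geodesic from \<open>a\<close> towards \<open>b\<close> until it first meets a geodesic from \<open>b\<close> to \<open>c\<close>,
  and the latter from there on, never visits a point twice. So this path traces the segment from
  \<open>a\<close> to \<open>c\<close>; the meeting point \<open>q\<close> is the centre of the tripod spanned by the three points.\<close>

lemma tripod:
  assumes "a \<in> M" "b \<in> M" "c \<in> M"
  obtains q where "q \<in> metric_segment a b" "q \<in> metric_segment b c" "q \<in> metric_segment a c"
    and "metric_segment a c \<subseteq> metric_segment a b \<union> metric_segment b c"
proof (cases "a = c")
  case True
  have "z = a" if "z \<in> metric_segment a a" for z
    using that assms(1) commute[of a z] zero[of a z] mdist_zero[of a] by (auto simp: metric_segment_def)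
  moreover have "a \<in> metric_segment a b" "a \<in> metric_segment b a" "a \<in> metric_segment a a"
    using assms by (simp_all add: metric_segment_def)
  ultimately show ?thesis
    using True by (intro that[of a]) auto
next
  case False
  obtain \<alpha> \<beta> where \<alpha>: "geodesic_arc a b \<alpha>" and \<beta>: "geodesic_arc b c \<beta>"
    using geodesic_arc_between assms by metis
  obtain s0 t0 where st: "s0 \<in> {0..d a b}" "t0 \<in> {0..d b c}" "\<alpha> s0 = \<beta> t0"
    and first: "\<And>s t. \<lbrakk>s \<in> {0..s0}; t \<in> {0..d b c}; \<alpha> s = \<beta> t\<rbrakk> \<Longrightarrow> s = s0"
    using first_meeting_point[OF \<alpha> \<beta>] by metis
  define \<eta> where "\<eta> u = (if u \<le> s0 then \<alpha> u else \<beta> (t0 + (u - s0)))" for u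
  define L where "L = s0 + (d b c - t0)"
  note K = broken_geodesic_Lipschitz[OF \<alpha> \<beta> st, folded \<eta>_def L_def]
  note \<alpha>_inj = inj_onD[OF geodesic_arc_inj_on[OF \<alpha>]] and \<beta>_inj = inj_onD[OF geodesic_arc_inj_on[OF \<beta>]]
  have cross: False if "u \<in> {0..s0}" "v \<in> {s0<..L}" "\<alpha> u = \<beta> (t0 + (v - s0))" for u v
  proof -
    have v: "t0 + (v - s0) \<in> {0..d b c}" using that st by (auto simp: L_def)
    then have "u = s0" using first that by blast
    then have "t0 = t0 + (v - s0)" using \<beta>_inj st v that by metis
    then show False using that by simp
  qed
  have "inj_on \<eta> {0..L}"
  proof (rule inj_onI)
    fix u v assume uv: "u \<in> {0..L}" "v \<in> {0..L}" "\<eta> u = \<eta> v"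
    consider "u \<le> s0" "v \<le> s0" | "u > s0" "v > s0" | "u \<le> s0" "v > s0" | "u > s0" "v \<le> s0"
      by linarith
    then show "u = v"
    proof cases
      case 1 then show ?thesis using \<alpha>_inj[of u v] uv st by (auto simp: \<eta>_def)
    next
      case 2 then show ?thesis 
        using \<beta>_inj[of "t0 + (u - s0)" "t0 + (v - s0)"] uv st by (auto simp: \<eta>_def L_def)
    next
      case 3 then show ?thesis using cross[of u v] uv by (auto simp: \<eta>_def)
    next
      case 4 then show ?thesis using cross[of v u] uv by (auto simp: \<eta>_def)
    qed
  qed
  moreover have "0 \<le> L" using st by (simp add: L_def)
  ultimately have seg: "metric_segment a c = \<alpha> ` {0..s0} \<union> \<beta> ` {t0..d b c}"
    using injective_Lipschitz_path_image[OF assms(1,3) False K(1-3)] K(4,5) by simp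
  have "\<alpha> ` {0..s0} \<subseteq> metric_segment a b" "\<beta> ` {t0..d b c} \<subseteq> metric_segment b c"
    using geodesic_arc_in_segment[OF \<alpha>] geodesic_arc_in_segment[OF \<beta>] st by auto
  then show ?thesis
    using geodesic_arc_in_segment[OF \<alpha>, of s0] geodesic_arc_in_segment[OF \<beta>, of t0] st
    by (intro that[of "\<alpha> s0"]) (auto simp: seg)
qed

text \<open>The centre \<open>q\<close> of the tripod of \<open>p\<close>, \<open>x\<close>, \<open>y\<close> has distance \<open>(x|y)\<^sub>p\<close> from \<open>p\<close>. Being on
  the segment from \<open>x\<close> to \<open>y\<close>, it lies on one of the segments from \<open>x\<close> to \<open>w\<close> and from \<open>w\<close> to
  \<open>y\<close>, and the distance from \<open>p\<close> to a point of a segment is at least the Gromov product of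
  the endpoints.\<close>

theorem four_point_condition:
  assumes M: "p \<in> M" "x \<in> M" "w \<in> M" "y \<in> M"
  shows "min (gromov_product p x w) (gromov_product p w y) \<le> gromov_product p x y"
proof -
  obtain q where q: "q \<in> metric_segment x p" "q \<in> metric_segment p y" "q \<in> metric_segment x y"
    using tripod[of x p y] M by metis
  then have qM: "q \<in> M" and pq: "d p q = gromov_product p x y"
    by (auto simp: metric_segment_def gromov_product_def commute)
  have through: "gromov_product p u v \<le> d p q" if "q \<in> metric_segment u v" "u \<in> M" "v \<in> M" for u v
    using triangle[of p q u] triangle[of p q v] that M qM
    by (auto simp: metric_segment_def gromov_product_def commute)
  have "metric_segment x y \<subseteq> metric_segment x w \<union> metric_segment w y"
    by (rule tripod[OF M(2,3,4)])
  then have "q \<in> metric_segment x w \<or> q \<in> metric_segment w y"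
    using q(3) by blast
  then show ?thesis
    using through[of x w] through[of w y] M unfolding pq by linarith
qed

end

section \<open>The merge tree of the distance from a point\<close>

context Metric_space
begin

lemma gromov_product_lower:
  shows "min (d p x) (d p y) - d x y / 2 \<le> gromov_product p x y"
  by (simp add: gromov_product_def min_def diff_divide_distrib add_divide_distrib)

text \<open>A topological form of walking along a chain of small steps in a connected set. The
  \<open>\<epsilon>\<close>-neighbourhoods of the points related to \<open>x\<close> and of the points not related to \<open>x\<close> cover \<open>A\<close>,
  and transitivity keeps them from meeting in \<open>A\<close>.\<close>

lemma connectedin_uniformly_local_trans:
  assumes A: "connectedin mtopology A" and "x \<in> A" "y \<in> A" and "0 < \<epsilon>"
    and local: "\<And>a b. \<lbrakk>a \<in> A; b \<in> A; d a b < \<epsilon>\<rbrakk> \<Longrightarrow> R a b"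
    and trans: "\<And>a b c. \<lbrakk>a \<in> A; b \<in> A; c \<in> A; R a b; R b c\<rbrakk> \<Longrightarrow> R a c"
  shows "R x y"
proof (rule ccontr)
  assume "\<not> R x y"
  have AM: "A \<subseteq> M" using connectedin_subset_topspace[OF A] by simp
  define U where "U = (\<Union>a\<in>{a \<in> A. R x a}. mball a \<epsilon>)"
  define V where "V = (\<Union>a\<in>{a \<in> A. \<not> R x a}. mball a \<epsilon>)"
  have "openin mtopology U" "openin mtopology V"
    by (auto simp: U_def V_def)
  moreover have self: "a \<in> mball a \<epsilon>" if "a \<in> A" for a
    using AM \<open>0 < \<epsilon>\<close> that by auto
  then have "A \<subseteq> U \<union> V"
    unfolding U_def V_def by blast
  moreover have "c \<notin> V" if c: "c \<in> A" "c \<in> U" for c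
  proof
    assume "c \<in> V"
    then obtain b where b: "b \<in> A" "\<not> R x b" "d b c < \<epsilon>" by (auto simp: V_def)
    obtain a where a: "a \<in> A" "R x a" "d a c < \<epsilon>" using c by (auto simp: U_def)
    have "R a c" "R c b"
      using local[of a c] local[of c b] a b c by (auto simp: commute)
    then show False
      using trans[of x a c] trans[of x c b] a b c \<open>x \<in> A\<close> by blast
  qed
  moreover have "x \<in> U"
    using local[of x x] self[of x] AM \<open>x \<in> A\<close> \<open>0 < \<epsilon>\<close> by (auto simp: U_def)
  moreover have "y \<in> V"
    using \<open>\<not> R x y\<close> self \<open>y \<in> A\<close> by (auto simp: V_def)
  ultimately show False
    using connectedinD[OF A, of U V] \<open>x \<in> A\<close> \<open>y \<in> A\<close> by blast
qed

end

context geodesic_space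
begin

lemma connected_mtopology: "connected_space mtopology"
proof (rule path_connected_imp_connected_space)
  show "path_connected_space mtopology"
    unfolding path_connected_space_def topspace_mtopology by (metis geodesic)
qed

lemma merge_setup_dist_from:
  assumes "compact_space mtopology" "p \<in> M"
  shows "merge_setup mtopology (\<lambda>x. - d p x)"
  using assms connected_mtopology continuous_map_dist_from[of p]
  by unfold_locales (auto intro: continuous_map_minus)

text \<open>A geodesic from \<open>x\<close> to \<open>y\<close> is a connected set on which \<open>- d p\<close> is at most \<open>- (x|y)\<^sub>p\<close>.\<close>

lemma merge_pdist_le_dist:
  assumes "compact_space mtopology" "p \<in> M" "x \<in> M" "y \<in> M"
  shows "merge_pdist mtopology (\<lambda>x. - d p x) x y \<le> d x y"
proof -
  interpret merge_setup mtopology "\<lambda>x. - d p x"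
    using merge_setup_dist_from assms by blast
  obtain \<gamma> where \<gamma>: "geodesic_arc x y \<gamma>"
    using geodesic_arc_between assms by metis
  define A where "A = \<gamma> ` {0..d x y}"
  have xy: "x \<in> A" "y \<in> A"
    unfolding A_def using geodesic_arcD(1,2)[OF \<gamma>] nonneg[of x y] by (metis atLeastAtMost_iff imageI order_refl)+
  have "- d p z \<le> - gromov_product p x y" if "z \<in> A" for z
  proof -
    have "z \<in> M" "d x z + d z y = d x y"
      using that geodesic_arc_in_segment[OF \<gamma>] by (auto simp: A_def metric_segment_def)
    then show ?thesis
      using triangle[of p z x] triangle[of p z y] assms commute[of z x] by (simp add: gromov_product_def)
  qed
  then have "Sup ((\<lambda>x. - d p x) ` A) \<le> - gromov_product p x y"
    using xy by (intro cSUP_least) auto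
  then have "merge_function mtopology (\<lambda>x. - d p x) x y \<le> - gromov_product p x y"
    using merge_function_lower[OF _ xy] geodesic_arc_connectedin[OF \<gamma>] by (force simp: A_def)
  then show ?thesis
    unfolding merge_pdist_def gromov_product_def by (simp add: field_simps)
qed

text \<open>Suppose that a connected set \<open>A\<close> stays farther than \<open>(x|y)\<^sub>p + 6 e\<close> from \<open>p\<close>. In the tree,
  Gromov products of images of nearby points of \<open>A\<close> are then large; the four-point condition makes
  this relation transitive, so it extends from nearby points to \<open>x\<close> and \<open>y\<close>, which contradicts the
  choice of \<open>A\<close>.\<close>

lemma dist_le_merge_pdist:
  assumes "compact_space mtopology" "p \<in> M" "x \<in> M" "y \<in> M"
    and T: "metric_tree T dT" and \<phi>: "\<phi> \<in> M \<rightarrow> T"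
    and near: "\<And>a b. \<lbrakk>a \<in> M; b \<in> M\<rbrakk> \<Longrightarrow> \<bar>dT (\<phi> a) (\<phi> b) - d a b\<bar> \<le> 2 * e"
  shows "d x y \<le> merge_pdist mtopology (\<lambda>x. - d p x) x y + 12 * e"
proof -
  interpret merge_setup mtopology "\<lambda>x. - d p x"
    using merge_setup_dist_from assms by blast
  interpret T: metric_tree T dT by (rule T)
  have "- gromov_product p x y - 6 * e \<le> Sup ((\<lambda>x. - d p x) ` A)" (is "_ \<le> ?S")
    if A: "connectedin mtopology A" "x \<in> A" "y \<in> A" for A
  proof (rule ccontr)
    assume "\<not> ?thesis"
    define \<epsilon> where "\<epsilon> = - gromov_product p x y - 6 * e - ?S"
    have "\<epsilon> > 0" using \<open>\<not> - gromov_product p x y - 6 * e \<le> ?S\<close> by (simp add: \<epsilon>_def)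
    have AM: "A \<subseteq> M" using connectedin_subset_topspace[OF A(1)] by simp
    have far: "- ?S - 2 * e \<le> dT (\<phi> p) (\<phi> a)" if "a \<in> A" for a
      using le_Sup[OF A(1) that] near[of p a] AM that \<open>p \<in> M\<close> by auto
    \<comment> \<open>A distance bound costs \<open>2 e\<close> on passing to the tree, a step of length \<open>\<epsilon> + 2 e\<close> there half
      of its length.\<close>
    define m where "m = - ?S - 3 * e - \<epsilon> / 2"
    have "m \<le> T.gromov_product (\<phi> p) (\<phi> x) (\<phi> y)"
    proof (rule connectedin_uniformly_local_trans[OF A \<open>\<epsilon> > 0\<close>, where R = "\<lambda>a b. m \<le> T.gromov_product (\<phi> p) (\<phi> a) (\<phi> b)"])
      fix a b assume ab: "a \<in> A" "b \<in> A" "d a b < \<epsilon>"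
      then have "a \<in> M" "b \<in> M" using AM by auto
      then have "dT (\<phi> a) (\<phi> b) \<le> \<epsilon> + 2 * e"
        using near[of a b] ab(3) by linarith
      then have "m \<le> min (dT (\<phi> p) (\<phi> a)) (dT (\<phi> p) (\<phi> b)) - dT (\<phi> a) (\<phi> b) / 2"
        using far[OF ab(1)] far[OF ab(2)] by (simp add: m_def field_simps)
      also have "\<dots> \<le> T.gromov_product (\<phi> p) (\<phi> a) (\<phi> b)"
        by (rule T.gromov_product_lower)
      finally show "m \<le> T.gromov_product (\<phi> p) (\<phi> a) (\<phi> b)" .
    next
      fix a b c assume "a \<in> A" "b \<in> A" "c \<in> A"
        and "m \<le> T.gromov_product (\<phi> p) (\<phi> a) (\<phi> b)" "m \<le> T.gromov_product (\<phi> p) (\<phi> b) (\<phi> c)"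
      moreover have "\<phi> p \<in> T" "\<phi> a \<in> T" "\<phi> b \<in> T" "\<phi> c \<in> T"
        using \<phi> AM assms(2) calculation by auto
      ultimately show "m \<le> T.gromov_product (\<phi> p) (\<phi> a) (\<phi> c)"
        using T.four_point_condition[of "\<phi> p" "\<phi> a" "\<phi> b" "\<phi> c"] by simp
    qed
    also have "\<dots> \<le> gromov_product p x y + 3 * e"
      using near[OF assms(2,3)] near[OF assms(2,4)] near[OF assms(3,4)]
      unfolding gromov_product_def T.gromov_product_def by (simp add: abs_le_iff field_simps)
    finally show False
      using \<open>\<epsilon> > 0\<close> by (simp add: m_def \<epsilon>_def field_simps)
  qed
  then have "- gromov_product p x y - 6 * e \<le> merge_function mtopology (\<lambda>x. - d p x) x y"
    using assms(3,4) by (intro merge_function_greatest) auto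
  then show ?thesis
    unfolding merge_pdist_def gromov_product_def by (simp add: field_simps)
qed

end

section \<open>Comparing spaces in Gromov--Hausdorff distance\<close>

lemma GH_distance_cong:
  assumes "\<And>x x'. \<lbrakk>x \<in> X; x' \<in> X\<rbrakk> \<Longrightarrow> dX x x' = dX' x x'"
    and "\<And>y y'. \<lbrakk>y \<in> Y; y' \<in> Y\<rbrakk> \<Longrightarrow> dY y y' = dY' y y'"
  shows "GH_distance X dX Y dY = GH_distance X dX' Y dY'"
proof -
  have "isometric_embedding X dX Z dZ f \<longleftrightarrow> isometric_embedding X dX' Z dZ f"
    for Z :: "('a + 'b) set" and dZ f
    unfolding isometric_embedding_def using assms(1) by auto
  moreover have "isometric_embedding Y dY Z dZ f \<longleftrightarrow> isometric_embedding Y dY' Z dZ f"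
    for Z :: "('a + 'b) set" and dZ f
    unfolding isometric_embedding_def using assms(2) by auto
  ultimately show ?thesis unfolding GH_distance_def by simp
qed

lemma GH_distance_less_imp_map:
  assumes "GH_distance X dX Y dY < ennreal e"
  obtains \<phi> where "\<phi> \<in> X \<rightarrow> Y"
    and "\<And>x x'. \<lbrakk>x \<in> X; x' \<in> X\<rbrakk> \<Longrightarrow> \<bar>dY (\<phi> x) (\<phi> x') - dX x x'\<bar> \<le> 2 * e"
proof -
  obtain Z :: "('a + 'b) set" and dZ f g where Z: "Metric_space Z dZ"
    and f: "isometric_embedding X dX Z dZ f" and g: "isometric_embedding Y dY Z dZ g"
    and "hausdorff_distance dZ (f ` X) (g ` Y) < ennreal e"
    using assms unfolding GH_distance_def by (auto simp: Inf_less_iff)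
  then obtain e' where e': "0 \<le> e'" "ennreal e' < ennreal e"
      "\<forall>a\<in>f ` X. \<exists>b\<in>g ` Y. dZ a b \<le> e'"
    unfolding hausdorff_distance_def by (auto simp: Inf_less_iff)
  then have "e' < e"
    using ennreal_less_iff by blast
  have "\<forall>x\<in>X. \<exists>y\<in>Y. dZ (f x) (g y) \<le> e"
    using e'(3) \<open>e' < e\<close> by force
  then obtain \<phi> where \<phi>: "\<And>x. x \<in> X \<Longrightarrow> \<phi> x \<in> Y \<and> dZ (f x) (g (\<phi> x)) \<le> e"
    by metis
  interpret Z: Metric_space Z dZ by (rule Z)
  show ?thesis
  proof (rule that)
    show "\<phi> \<in> X \<rightarrow> Y" using \<phi> by auto
    fix x x' assume x: "x \<in> X" "x' \<in> X"
    have Zs: "f x \<in> Z" "f x' \<in> Z" "g (\<phi> x) \<in> Z" "g (\<phi> x') \<in> Z"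
      using f g \<phi> x by (auto simp: isometric_embedding_def)
    have "\<bar>dZ (g (\<phi> x)) (g (\<phi> x')) - dZ (f x) (f x')\<bar> \<le> 2 * e"
      using Z.triangle[of "f x" "g (\<phi> x)" "f x'"] Z.triangle[of "g (\<phi> x)" "g (\<phi> x')" "f x'"]
        Z.triangle[of "g (\<phi> x)" "f x" "g (\<phi> x')"] Z.triangle[of "f x" "f x'" "g (\<phi> x')"]
        \<phi>[OF x(1)] \<phi>[OF x(2)] Zs Z.commute[of "f x" "g (\<phi> x)"] Z.commute[of "f x'" "g (\<phi> x')"]
      by linarith
    then show "\<bar>dY (\<phi> x) (\<phi> x') - dX x x'\<bar> \<le> 2 * e"
      using f g x \<phi> by (simp add: isometric_embedding_def)
  qed
qed

text \<open>Both spaces are glued in their disjoint union, with \<open>dY (\<pi> x) y + \<delta>\<close> as the distance between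
  \<open>x\<close> and \<open>y\<close>. That \<open>\<pi>\<close> does not increase distances makes this explicit formula satisfy the
  triangle inequality, so that no infimum over intermediate points is taken; \<open>\<delta> > 0\<close> separates
  \<open>x\<close> from \<open>\<pi> x\<close>.\<close>

lemma GH_distance_le_surjection:
  fixes X :: "'a set" and Y :: "'b set"
  assumes "Metric_space X dX" "Metric_space Y dY" and surj: "\<pi> ` X = Y" and "0 < \<delta>"
    and short: "\<And>x x'. \<lbrakk>x \<in> X; x' \<in> X\<rbrakk> \<Longrightarrow> dY (\<pi> x) (\<pi> x') \<le> dX x x'"
    and dist: "\<And>x x'. \<lbrakk>x \<in> X; x' \<in> X\<rbrakk> \<Longrightarrow> dX x x' \<le> dY (\<pi> x) (\<pi> x') + 2 * \<delta>"
  shows "GH_distance X dX Y dY \<le> ennreal \<delta>"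
proof -
  interpret X: Metric_space X dX by fact
  interpret Y: Metric_space Y dY by fact
  define Z where "Z = Inl ` X \<union> Inr ` Y"
  define dZ :: "'a + 'b \<Rightarrow> 'a + 'b \<Rightarrow> real" where
    "dZ u v = (case (u, v) of (Inl x, Inl x') \<Rightarrow> dX x x' | (Inr y, Inr y') \<Rightarrow> dY y y'
       | (Inl x, Inr y) \<Rightarrow> dY (\<pi> x) y + \<delta> | (Inr y, Inl x) \<Rightarrow> dY (\<pi> x) y + \<delta>)" for u v
  have \<pi>: "\<pi> x \<in> Y" if "x \<in> X" for x using surj that by blast
  have pos: "dY y y' + \<delta> \<noteq> 0" "0 \<le> dY y y' + \<delta>" for y y'
    using Y.nonneg[of y y'] \<open>0 < \<delta>\<close> by linarith+
  have Z: "Metric_space Z dZ"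
  proof
    show "0 \<le> dZ u v" for u v
      using pos by (auto simp: dZ_def split: sum.split)
    show "dZ u v = dZ v u" for u v
      by (auto simp: dZ_def X.commute Y.commute split: sum.split)
    show "dZ u v = 0 \<longleftrightarrow> u = v" if "u \<in> Z" "v \<in> Z" for u v
      using that pos by (auto simp: dZ_def Z_def)
    show "dZ u w \<le> dZ u v + dZ v w" if "u \<in> Z" "v \<in> Z" "w \<in> Z" for u v w
    proof -
      have XYX: "dX x x' \<le> (dY (\<pi> x) y + \<delta>) + (dY (\<pi> x') y + \<delta>)" if "x \<in> X" "y \<in> Y" "x' \<in> X" for x x' y
        using dist[of x x'] Y.triangle[of "\<pi> x" y "\<pi> x'"] Y.commute[of y "\<pi> x'"] \<pi>[of x] \<pi>[of x'] that
        by linarith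
      have YXY: "dY y y' \<le> (dY (\<pi> x) y + \<delta>) + (dY (\<pi> x) y' + \<delta>)" if "y \<in> Y" "x \<in> X" "y' \<in> Y" for x y y'
        using Y.triangle[of y "\<pi> x" y'] Y.commute[of y "\<pi> x"] \<pi>[of x] that \<open>0 < \<delta>\<close> by linarith
      have XXY: "dY (\<pi> x) y + \<delta> \<le> dX x x' + (dY (\<pi> x') y + \<delta>)" if "x \<in> X" "x' \<in> X" "y \<in> Y" for x x' y
        using Y.triangle[of "\<pi> x" "\<pi> x'" y] short[of x x'] \<pi>[of x] \<pi>[of x'] that by linarith
      have YXX: "dY (\<pi> x') y + \<delta> \<le> (dY (\<pi> x) y + \<delta>) + dX x x'" if "y \<in> Y" "x \<in> X" "x' \<in> X" for x x' y
        using XXY[of x' x y] X.commute[of x x'] that by linarith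
      have XYY: "dY (\<pi> x) y + \<delta> \<le> (dY (\<pi> x) y' + \<delta>) + dY y' y" if "x \<in> X" "y' \<in> Y" "y \<in> Y" for x y y'
        using Y.triangle[of "\<pi> x" y' y] \<pi>[of x] that by linarith
      have YYX: "dY (\<pi> x) y + \<delta> \<le> dY y y' + (dY (\<pi> x) y' + \<delta>)" if "y \<in> Y" "y' \<in> Y" "x \<in> X" for x y y'
        using XYY[of x y' y] Y.commute[of y y'] that by linarith
      have dZ: "dZ (Inl x) (Inl x') = dX x x'" "dZ (Inr y) (Inr y') = dY y y'"
        "dZ (Inl x) (Inr y) = dY (\<pi> x) y + \<delta>" "dZ (Inr y) (Inl x) = dY (\<pi> x) y + \<delta>" for x x' y y'
        by (simp_all add: dZ_def)
      have in_Z: "Inl x \<in> Z \<longleftrightarrow> x \<in> X" "Inr y \<in> Z \<longleftrightarrow> y \<in> Y" for x y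
        by (auto simp: Z_def)
      show ?thesis
        by (insert that; cases u; cases v; cases w; simp only: dZ in_Z;
            rule X.triangle Y.triangle XXY XYX XYY YXX YXY YYX; assumption)
    qed
  qed
  have "isometric_embedding X dX Z dZ Inl" "isometric_embedding Y dY Z dZ Inr"
    by (auto simp: isometric_embedding_def Z_def dZ_def)
  then have "GH_distance X dX Y dY \<le> hausdorff_distance dZ (Inl ` X) (Inr ` Y)"
    unfolding GH_distance_def using Z by (intro Inf_lower) blast
  also have "\<dots> \<le> ennreal \<delta>"
  proof -
    have "dZ (Inl x) (Inr (\<pi> x)) = \<delta>" if "x \<in> X" for x
      using \<pi>[OF that] by (simp add: dZ_def)
    then have "\<forall>a\<in>Inl ` X. \<exists>b\<in>Inr ` Y. dZ a b \<le> \<delta>" "\<forall>b\<in>Inr ` Y. \<exists>a\<in>Inl ` X. dZ a b \<le> \<delta>"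
      unfolding surj[symmetric] by force+
    then show ?thesis
      unfolding hausdorff_distance_def using \<open>0 < \<delta>\<close> by (intro Inf_lower) auto
  qed
  finally show ?thesis .
qed

section \<open>The merge tree as a quotient of the space\<close>

context merge_setup
begin

text \<open>\<open>Metric_space\<close> asks for nonnegativity and symmetry on the whole type, while
  \<open>merge_tree_dist\<close> has a meaning only for classes; hence the value 0 elsewhere.\<close>

lemma merge_tree_metric:
  "Metric_space (merge_tree X f)
     (\<lambda>C D. if C \<in> merge_tree X f \<and> D \<in> merge_tree X f then merge_tree_dist X f C D else 0)"
proof -
  have rep: "\<exists>x\<in>topspace X. x \<in> C" if "C \<in> merge_tree X f" for C
    using that merge_rel_equiv unfolding merge_tree_def
    by (metis in_quotient_imp_non_empty in_quotient_imp_subset subset_empty subset_iff ex_in_conv)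
  have comm: "merge_tree_dist X f C D = merge_tree_dist X f D C"
    if "C \<in> merge_tree X f" "D \<in> merge_tree X f" for C D
    unfolding merge_tree_dist_def by (rule merge_pdist_commute)
  show ?thesis
  proof
    fix C D assume CD: "C \<in> merge_tree X f" "D \<in> merge_tree X f"
    then obtain x y where xy: "x \<in> C" "y \<in> D" "x \<in> topspace X" "y \<in> topspace X"
      using rep by blast
    then have "merge_tree_dist X f C D = 0 \<longleftrightarrow> (x, y) \<in> merge_rel X f"
      using merge_tree_dist_class[OF CD] by (simp add: merge_rel_def)
    also have "\<dots> \<longleftrightarrow> C = D"
      using quotient_eq_iff[OF merge_rel_equiv] CD xy unfolding merge_tree_def by metis
    finally show "(if C \<in> merge_tree X f \<and> D \<in> merge_tree X f then merge_tree_dist X f C D else 0) = 0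
        \<longleftrightarrow> C = D" using CD by simp
  next
    fix C D E assume CDE: "C \<in> merge_tree X f" "D \<in> merge_tree X f" "E \<in> merge_tree X f"
    then obtain x y z where "x \<in> C" "y \<in> D" "z \<in> E" "x \<in> topspace X" "y \<in> topspace X" "z \<in> topspace X"
      using rep by meson
    then show "(if C \<in> merge_tree X f \<and> E \<in> merge_tree X f then merge_tree_dist X f C E else 0)
      \<le> (if C \<in> merge_tree X f \<and> D \<in> merge_tree X f then merge_tree_dist X f C D else 0)
        + (if D \<in> merge_tree X f \<and> E \<in> merge_tree X f then merge_tree_dist X f D E else 0)"
      using CDE merge_tree_dist_class merge_pdist_triangle by simp
  next
    show "0 \<le> (if C \<in> merge_tree X f \<and> D \<in> merge_tree X f then merge_tree_dist X f C D else 0)" for C D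
      using rep[of C] rep[of D] merge_tree_dist_class merge_pdist_nonneg by fastforce
  qed (auto simp: comm)
qed

lemma merge_tree_projection:
  "(\<lambda>x. merge_rel X f `` {x}) ` topspace X = merge_tree X f"
  "\<lbrakk>x \<in> topspace X; y \<in> topspace X\<rbrakk> \<Longrightarrow>
    merge_tree_dist X f (merge_rel X f `` {x}) (merge_rel X f `` {y}) = merge_pdist X f x y"
proof -
  show img: "(\<lambda>x. merge_rel X f `` {x}) ` topspace X = merge_tree X f"
    by (auto simp: merge_tree_def quotient_def)
  show "merge_tree_dist X f (merge_rel X f `` {x}) (merge_rel X f `` {y}) = merge_pdist X f x y"
    if "x \<in> topspace X" "y \<in> topspace X"
    using that img equiv_class_self[OF merge_rel_equiv] by (intro merge_tree_dist_class) auto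
qed

end

text \<open>For every \<open>e\<close> above the distance from \<open>X\<close> to the tree, the quotient map onto the merge tree
  satisfies the hypotheses of \<open>GH_distance_le_surjection\<close> with \<open>\<delta> = 6 e\<close>.\<close>

theorem GH_distance_merge_tree_le:
  fixes X :: "'a set" and dX :: "'a \<Rightarrow> 'a \<Rightarrow> real" and p :: 'a
    and T :: "'b set" and dT :: "'b \<Rightarrow> 'b \<Rightarrow> real"
  assumes "geodesic_space X dX" and "compact_space (Metric_space.mtopology X dX)" and "p \<in> X"
    and "metric_tree T dT"
  shows "GH_distance X dX
           (merge_tree (Metric_space.mtopology X dX) (\<lambda>x. - dX p x))
           (merge_tree_dist (Metric_space.mtopology X dX) (\<lambda>x. - dX p x))
         \<le> 6 * GH_distance X dX T dT" (is "GH_distance _ _ ?Y ?dY \<le> 6 * ?G")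
proof -
  interpret X: geodesic_space X dX by fact
  let ?f = "\<lambda>x. - dX p x"
  interpret merge_setup X.mtopology ?f
    using X.merge_setup_dist_from assms by blast
  define dY where "dY C D = (if C \<in> ?Y \<and> D \<in> ?Y then ?dY C D else 0)" for C D
  define \<pi> where "\<pi> x = merge_rel X.mtopology ?f `` {x}" for x
  have \<pi>: "\<pi> ` X = ?Y"
    using merge_tree_projection(1) by (simp add: \<pi>_def)
  have dY: "dY (\<pi> x) (\<pi> y) = merge_pdist X.mtopology ?f x y" if "x \<in> X" "y \<in> X" for x y
    using that \<pi> merge_tree_projection(2)[of x y] by (auto simp: dY_def \<pi>_def)
  have bound: "GH_distance X dX ?Y ?dY \<le> ennreal (6 * e)" if e: "?G < ennreal e" for e
  proof -
    obtain \<phi> where \<phi>: "\<phi> \<in> X \<rightarrow> T"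
      "\<And>x x'. \<lbrakk>x \<in> X; x' \<in> X\<rbrakk> \<Longrightarrow> \<bar>dT (\<phi> x) (\<phi> x') - dX x x'\<bar> \<le> 2 * e"
      by (rule GH_distance_less_imp_map[OF e]) blast
    have "0 < e"
      using e by (metis ennreal_neg not_le not_less_zero)
    have "GH_distance X dX ?Y ?dY = GH_distance X dX ?Y dY"
      by (intro GH_distance_cong) (auto simp: dY_def)
    also have "\<dots> \<le> ennreal (6 * e)"
    proof (rule GH_distance_le_surjection[OF X.Metric_space_axioms _ \<pi>])
      show "Metric_space ?Y dY" using merge_tree_metric by (simp add: dY_def[abs_def])
      show "0 < 6 * e" using \<open>0 < e\<close> by simp
      show "dY (\<pi> x) (\<pi> y) \<le> dX x y" if "x \<in> X" "y \<in> X" for x y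
        using X.merge_pdist_le_dist assms(2,3) that by (simp add: dY)
      show "dX x y \<le> dY (\<pi> x) (\<pi> y) + 2 * (6 * e)" if "x \<in> X" "y \<in> X" for x y
        using X.dist_le_merge_pdist[OF assms(2,3) that assms(4) \<phi>] that by (simp add: dY)
    qed
    finally show ?thesis .
  qed
  show ?thesis
  proof (cases "?G" rule: ennreal_cases)
    case (real g)
    show ?thesis
    proof (rule ennreal_le_epsilon)
      fix \<epsilon> :: real assume "0 < \<epsilon>"
      have "GH_distance X dX ?Y ?dY \<le> ennreal (6 * (g + \<epsilon> / 6))"
        using real \<open>0 < \<epsilon>\<close> by (intro bound) (simp add: ennreal_less_iff)
      also have "\<dots> = 6 * ?G + ennreal \<epsilon>"
        using real \<open>0 < \<epsilon>\<close> by (simp add: distrib_left ennreal_mult)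
      finally show "GH_distance X dX ?Y ?dY \<le> 6 * ?G + ennreal \<epsilon>" .
    qed
  qed (simp add: ennreal_mult_top)
qed

theorem theorem10:
  fixes X :: "'a set" and dX :: "'a \<Rightarrow> 'a \<Rightarrow> real" and p :: 'a
    and T :: "'b set" and dT :: "'b \<Rightarrow> 'b \<Rightarrow> real"
  assumes "geodesic_space X dX" and "compact_space (Metric_space.mtopology X dX)" and "p \<in> X"
    and "metric_tree T dT" and "compact_space (Metric_space.mtopology T dT)"
  shows "GH_distance X dX
           (merge_tree (Metric_space.mtopology X dX) (\<lambda>x. - dX p x))
           (merge_tree_dist (Metric_space.mtopology X dX) (\<lambda>x. - dX p x))
         \<le> 13 * GH_distance X dX T dT"
proof -
  have "6 * GH_distance X dX T dT \<le> 13 * GH_distance X dX T dT"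
    by (intro mult_right_mono) auto
  with GH_distance_merge_tree_le[OF assms(1-4)] show ?thesis by (rule order_trans)
qed

end
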